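(* Let $d\neq 1$ be a squarefree integer, and let $p_1,p_2,\dots$ be the primes $p$ with $\left(\frac{d}{p}\right)\neq 1$. Then $$R_+(\sqrt d)=\mathcal{O}_{\mathbb{Q}(\sqrt d)}\left[\frac1{p_1},\frac1{p_2},\dots\right].$$
   Context: For $\alpha\in\mathbb{C}$, $R_+(\alpha)$ denotes the set of all finite sums $\sum_{k\ge 0} a_k\binom{\alpha}{k}$ with $a_k\in\mathbb{Z}_{\ge 0}$, where $\binom{\alpha}{k}=\frac{\alpha(\alpha-1)\cdots(\alpha-k+1)}{k!}$. $\mathcal{O}_{\mathbb{Q}(\sqrt d)}$ is the ring of integers of $\mathbb{Q}(\sqrt d)$, and the right-hand side is the subring of $\mathbb{Q}(\sqrt d)$ generated by it and the listed elements. For odd $p$, $\left(\frac dp\right)$ is the Legendre symbol (equal to $0$ if $p\mid d$). For $p=2$ it is extended by: $\left(\frac d2\right)=1$ if $d\equiv 1\pmod 8$; $\left(\frac d2\right)=-1$ if $d\equiv5\pmod 8$; $\left(\frac d2\right)=i$ (the imaginary unit) if $d\equiv 3\pmod 4$; and $\left(\frac d2\right)=0$ if $d$ is even. *)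

theory Defs
  imports
    Complex_Main
    "HOL-Computational_Algebra.Computational_Algebra"
    "HOL-Number_Theory.Number_Theory"
begin

definition R_plus :: "complex \<Rightarrow> complex set" where
  "R_plus \<alpha> = {\<Sum>k\<le>n. of_nat (a k) * (\<alpha> gchoose k) | (a :: nat \<Rightarrow> nat) (n :: nat). True}"

definition is_subring :: "complex set \<Rightarrow> bool" where
  "is_subring R \<longleftrightarrow> 0 \<in> R \<and> 1 \<in> R \<and>
     (\<forall>x\<in>R. - x \<in> R) \<and> (\<forall>x\<in>R. \<forall>y\<in>R. x + y \<in> R \<and> x * y \<in> R)"

definition is_subfield :: "complex set \<Rightarrow> bool" where
  "is_subfield K \<longleftrightarrow> is_subring K \<and> (\<forall>x\<in>K. x \<noteq> 0 \<longrightarrow> inverse x \<in> K)"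

definition subring_gen :: "complex set \<Rightarrow> complex set" where
  "subring_gen S = is_subring hull S"

(* For negative d, csqrt gives the root with positive imaginary part. *)
definition quadratic_field :: "int \<Rightarrow> complex set" where
  "quadratic_field d = is_subfield hull {csqrt (of_int d)}"

definition ring_of_integers :: "complex set \<Rightarrow> complex set" where
  "ring_of_integers K = {x \<in> K. algebraic_int x}"

(* The Legendre symbol, extended to p = 2. The value \<i> there makes the symbol complex-valued. *)
definition ext_legendre :: "int \<Rightarrow> nat \<Rightarrow> complex" where
  "ext_legendre d p =
     (if p = 2 then
        (if [d = 1] (mod 8) then 1
         else if [d = 5] (mod 8) then -1
         else if [d = 3] (mod 4) then \<i>
         else 0)
      else of_int (Legendre d (int p)))"

end

theory Submission
  imports Defs
begin

text \<open>
  Write \<open>\<alpha> = \<surd>d\<close>. The numbers \<open>\<alpha> choose k\<close> span \<open>R\<^sub>+(\<alpha>)\<close> and satisfy a three-term recurrence whose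
  coefficients eventually have the same sign; this yields \<open>0\<close> as a sum of elements of \<open>R\<^sub>+(\<alpha>)\<close> and
  forces \<open>R\<^sub>+(\<alpha>)\<close> to be a ring.
  If \<open>p\<close> does not split, then \<open>p\<close> divides few norms \<open>j\<^sup>2 - d\<close> of the factors \<open>\<alpha> - j\<close>, and these
  factors can be cancelled from \<open>\<alpha>(\<alpha> - 1)\<cdots>(\<alpha> - p + 1) / p\<close> to obtain \<open>1 / p\<close>
  (for \<open>p = 2\<close> one also uses \<open>(\<alpha> - 1) / 2\<close>, and \<open>\<alpha> choose 4\<close> if \<open>d \<equiv> 5 (mod 8)\<close>).
  Conversely, if \<open>p\<close> splits then \<open>\<alpha>\<close> is congruent to an integer modulo every power of each prime
  above \<open>p\<close>, so that \<open>\<alpha> choose k\<close> is integral there.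
\<close>

subsection \<open>The semiring of nonnegative combinations\<close>

lemma R_plusI: "(\<Sum>k\<le>n. of_nat (a k) * (\<alpha> gchoose k)) \<in> R_plus \<alpha>"
  unfolding R_plus_def by blast

lemma R_plus_gbinomial: "\<alpha> gchoose k \<in> R_plus \<alpha>"
proof -
  have "\<alpha> gchoose k = (\<Sum>j\<le>k. of_nat (if j = k then 1 else 0) * (\<alpha> gchoose j))"
    using sum.delta[of "{..k}" k "\<lambda>j. \<alpha> gchoose j"]
    by (simp add: if_distrib[of of_nat] if_distrib[of "\<lambda>x. x * _"] cong: if_cong)
  then show ?thesis
    by (simp only: R_plusI)
qed

lemma R_plus_0: "0 \<in> R_plus \<alpha>"
  using R_plusI[of "\<lambda>_. 0" \<alpha> 0] by simp

lemma R_plus_add: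
  assumes "x \<in> R_plus \<alpha>" "y \<in> R_plus \<alpha>"
  shows "x + y \<in> R_plus \<alpha>"
proof -
  \<comment> \<open>Zero coefficients bring both sums to the common length
    \<open>n + m\<close>.\<close>
  have pad: "(\<Sum>k\<le>n. of_nat (a k) * (\<alpha> gchoose k))
      = (\<Sum>k\<le>n + m. of_nat (if k \<le> n then a k else 0) * (\<alpha> gchoose k))"
    for a :: "nat \<Rightarrow> nat" and n m
    by (rule sum.mono_neutral_cong_left) auto
  obtain a n b m where x: "x = (\<Sum>k\<le>n. of_nat (a k) * (\<alpha> gchoose k))"
    and y: "y = (\<Sum>k\<le>m. of_nat (b k) * (\<alpha> gchoose k))"
    using assms unfolding R_plus_def by blast
  have "x + y = (\<Sum>k\<le>n + m. of_nat ((if k \<le> n then a k else 0) + (if k \<le> m then b k else 0)) * (\<alpha> gchoose k))"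
    unfolding x y pad[of a n m] pad[of b m n] add.commute[of m n]
    by (simp only: sum.distrib[symmetric] of_nat_add distrib_right)
  then show ?thesis
    by (simp only: R_plusI)
qed

lemma R_plus_of_nat_mult: "x \<in> R_plus \<alpha> \<Longrightarrow> of_nat n * x \<in> R_plus \<alpha>"
  by (induction n) (auto simp: R_plus_0 R_plus_add algebra_simps)

text \<open>Natural coefficients are repeated sums, so additivity absorbs them and only single
  binomials remain to be checked.\<close>

lemma R_plus_induct [consumes 1, case_names zero gbinomial add]:
  assumes "x \<in> R_plus \<alpha>" "P 0" "\<And>k. P (\<alpha> gchoose k)" "\<And>x y. P x \<Longrightarrow> P y \<Longrightarrow> P (x + y)"
  shows "P x"
proof -
  obtain a n where x: "x = (\<Sum>k\<le>n. of_nat (a k) * (\<alpha> gchoose k))"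
    using assms(1) unfolding R_plus_def by blast
  have mult: "P (of_nat m * (\<alpha> gchoose k))" for m k
    by (induction m) (auto simp: assms(2-4) distrib_right)
  have "P (\<Sum>k\<le>n. of_nat (a k) * (\<alpha> gchoose k))"
    using mult[of _ 0] by (induction n) (auto simp: assms(2-4) mult simp del: gbinomial_0)
  then show ?thesis
    by (simp add: x)
qed

text \<open>Vandermonde for \<open>x = (x - j) + j\<close> expands the second factor, and trinomial
  revision merges each term with \<open>x gchoose j\<close>. What matters is that the coefficients
  are natural numbers.\<close>

lemma gbinomial_mult_eq_sum:
  fixes x :: "'a :: field_char_0"
  shows "(x gchoose j) * (x gchoose k)
    = (\<Sum>i\<le>k. of_nat (((j + i) choose j) * (j choose (k - i))) * (x gchoose (j + i)))"
proof -
  have "x gchoose k = (\<Sum>i\<le>k. ((x - of_nat j) gchoose i) * (of_nat j gchoose (k - i)))"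
    using gbinomial_Vandermonde[of "x - of_nat j" "of_nat j" k] by (simp add: atMost_atLeast0)
  then have "(x gchoose j) * (x gchoose k)
      = (\<Sum>i\<le>k. (x gchoose j) * ((x - of_nat j) gchoose i) * (of_nat j gchoose (k - i)))"
    by (simp add: sum_distrib_left mult.assoc)
  also have "\<dots> = (\<Sum>i\<le>k. (x gchoose (j + i)) * (of_nat (j + i) gchoose j) * (of_nat j gchoose (k - i)))"
    using gbinomial_trinomial_revision[of j "j + i" x for i] by simp
  finally show ?thesis
    by (simp add: binomial_gbinomial mult_ac)
qed

lemma R_plus_sum: "(\<And>i. i \<in> I \<Longrightarrow> f i \<in> R_plus \<alpha>) \<Longrightarrow> sum f I \<in> R_plus \<alpha>"
  by (induction I rule: infinite_finite_induct) (auto simp: R_plus_0 R_plus_add)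

lemma R_plus_mult:
  assumes "x \<in> R_plus \<alpha>" "y \<in> R_plus \<alpha>"
  shows "x * y \<in> R_plus \<alpha>"
  using assms(1)
proof (induction rule: R_plus_induct)
  case (gbinomial j)
  show ?case
    using assms(2)
  proof (induction rule: R_plus_induct)
    case (gbinomial k)
    show ?case
      unfolding gbinomial_mult_eq_sum by (intro R_plus_sum R_plus_of_nat_mult R_plus_gbinomial)
  qed (auto simp: R_plus_0 R_plus_add distrib_left)
qed (auto simp: R_plus_0 R_plus_add distrib_right)

section \<open>Additive inverses for a quadratic irrational\<close>

locale quadratic_irrational =
  fixes d :: int and \<alpha> :: complex
  assumes squarefree_d: "squarefree d" and d_neq_1: "d \<noteq> 1" and \<alpha>_squared: "\<alpha>\<^sup>2 = of_int d"
begin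

lemma \<alpha>_mult_\<alpha> [simp]: "\<alpha> * \<alpha> = of_int d"
  using \<alpha>_squared by (simp add: power2_eq_square)

text \<open>Makes \<alpha> irrational and keeps the coefficient d - k^2 of the recurrence below from
  vanishing.\<close>

lemma d_neq_power2: "d \<noteq> r\<^sup>2"
proof
  assume "d = r\<^sup>2"
  then have "is_unit r"
    using squarefreeD[OF squarefree_d] by simp
  then have "r\<^sup>2 = 1"
    by (simp add: power2_eq_1_iff abs_eq_iff')
  with \<open>d = r\<^sup>2\<close> d_neq_1 show False
    by simp
qed

lemma \<alpha>_not_rational: "\<alpha> \<notin> \<rat>"
proof
  assume "\<alpha> \<in> \<rat>"
  moreover have "algebraic_int \<alpha>"
    by (rule algebraic_int.intros[of "[:- of_int d, 0, 1:]"])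
      (auto simp: coeff_pCons split: nat.splits)
  ultimately obtain r where "\<alpha> = of_int r"
    using rational_algebraic_int_is_int by (auto elim: Ints_cases)
  then have "of_int d = (of_int (r\<^sup>2) :: complex)"
    using \<alpha>_squared by simp
  then show False
    using d_neq_power2 of_int_eq_iff by blast
qed

lemma rat_lin_comb_eq_0D:
  assumes "of_rat a + of_rat b * \<alpha> = 0"
  shows "a = 0" "b = 0"
proof -
  show "b = 0"
  proof (rule ccontr)
    assume "b \<noteq> 0"
    then have "\<alpha> = of_rat (- a / b)"
      using assms by (simp add: of_rat_divide of_rat_minus field_simps eq_neg_iff_add_eq_0)
    then show False
      using \<alpha>_not_rational by simp
  qed
  then show "a = 0"
    using assms by simp
qed

text \<open>Units in the additive sense: the largest additive group inside
  \<open>R_plus \<alpha>\<close>.\<close>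

definition R_plus_units :: "complex set" where
  "R_plus_units = {x \<in> R_plus \<alpha>. - x \<in> R_plus \<alpha>}"

lemma R_plus_units_add: "x \<in> R_plus_units \<Longrightarrow> y \<in> R_plus_units \<Longrightarrow> x + y \<in> R_plus_units"
  using R_plus_add[of "- x" \<alpha> "- y"] by (auto simp: R_plus_units_def R_plus_add)

lemma R_plus_units_of_nat_mult: "x \<in> R_plus_units \<Longrightarrow> of_nat n * x \<in> R_plus_units"
  using R_plus_of_nat_mult[of "- x" \<alpha> n] by (auto simp: R_plus_units_def R_plus_of_nat_mult)

text \<open>Adding \<open>y\<close> to \<open>- (x + y)\<close> gives \<open>- x\<close>. In
  particular the summands of any representation of 0 are additively invertible.\<close>

lemma R_plus_units_addD:
  assumes "x + y \<in> R_plus_units" "x \<in> R_plus \<alpha>" "y \<in> R_plus \<alpha>"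
  shows "x \<in> R_plus_units"
  using assms R_plus_add[of "- (x + y)" \<alpha> y] by (auto simp: R_plus_units_def)

lemma R_plus_units_of_nat_multD:
  assumes "of_nat n * x \<in> R_plus_units" "n > 0" "x \<in> R_plus \<alpha>"
  shows "x \<in> R_plus_units"
proof -
  have "of_nat n * x = x + of_nat (n - 1) * x"
    using assms(2) by (simp add: of_nat_diff algebra_simps)
  then show ?thesis
    using assms R_plus_units_addD[of x "of_nat (n - 1) * x"] R_plus_of_nat_mult by metis
qed

text \<open>Multiplication by \<alpha> sends the binomial at j to j times itself plus j + 1 times
  the next one. Applying this twice and using \<alpha>^2 = d gives the three terms.\<close>

lemma gbinomial_recurrence:
  "of_int (d - (int k)\<^sup>2) * (\<alpha> gchoose k) = of_nat ((k + 1) * (2 * k + 1)) * (\<alpha> gchoose (k + 1))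
     + of_nat ((k + 1) * (k + 2)) * (\<alpha> gchoose (k + 2))"
proof -
  have step: "\<alpha> * (\<alpha> gchoose j) = of_nat j * (\<alpha> gchoose j) + of_nat (j + 1) * (\<alpha> gchoose (j + 1))" for j
    using gbinomial_mult_1[of \<alpha> j] by simp
  have "of_int d * (\<alpha> gchoose k) = \<alpha> * (\<alpha> * (\<alpha> gchoose k))"
    by (simp add: mult.assoc[symmetric])
  also have "\<dots> = of_nat k * (\<alpha> * (\<alpha> gchoose k)) + of_nat (k + 1) * (\<alpha> * (\<alpha> gchoose (k + 1)))"
    by (subst step) (simp only: distrib_left mult.left_commute)
  also have "\<dots> = of_nat k * (of_nat k * (\<alpha> gchoose k) + of_nat (k + 1) * (\<alpha> gchoose (k + 1)))
      + of_nat (k + 1) * (of_nat (k + 1) * (\<alpha> gchoose (k + 1)) + of_nat (k + 2) * (\<alpha> gchoose (k + 2)))"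
    unfolding step[of k] step[of "k + 1"] by (simp add: add.assoc)
  finally show ?thesis
    by (simp add: algebra_simps power2_eq_square)
qed

text \<open>In the recurrence all coefficients have the same sign once \<open>k\<^sup>2 > d\<close>, so it exhibits
  \<open>0\<close> as a sum of elements of \<^term>\<open>R_plus \<alpha>\<close>, each of which is then a unit; for the remaining
  \<open>k\<close> the recurrence propagates this downwards.\<close>

lemma gbinomial_unit: "\<alpha> gchoose k \<in> R_plus_units"
\<comment> \<open>Only the case k^2 <= d uses the induction hypothesis; there k <= k^2 <= d, so the
  measure is positive and drops at k + 1 and k + 2.\<close>
proof (induction "nat (d + 1) - k" arbitrary: k rule: less_induct)
  case less
  let ?y = "of_nat ((k + 1) * (2 * k + 1)) * (\<alpha> gchoose (k + 1))
    + of_nat ((k + 1) * (k + 2)) * (\<alpha> gchoose (k + 2))"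
  have y: "?y \<in> R_plus \<alpha>"
    by (intro R_plus_add R_plus_of_nat_mult R_plus_gbinomial)
  show ?case
  proof (cases "d < (int k)\<^sup>2")
    case True
    define m where "m = nat ((int k)\<^sup>2 - d)"
    have m: "m > 0" "d - (int k)\<^sup>2 = - int m"
      using True by (auto simp: m_def)
    have "of_nat m * (\<alpha> gchoose k) + ?y = 0"
      unfolding gbinomial_recurrence[symmetric] m(2) by simp
    then have "of_nat m * (\<alpha> gchoose k) + ?y \<in> R_plus_units"
      by (simp add: R_plus_units_def R_plus_0)
    then have "of_nat m * (\<alpha> gchoose k) \<in> R_plus_units"
      using y by (auto intro: R_plus_units_addD R_plus_of_nat_mult R_plus_gbinomial)
    then show ?thesis
      using m R_plus_units_of_nat_multD R_plus_gbinomial by blast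
  next
    case False
    define m where "m = nat (d - (int k)\<^sup>2)"
    have m: "m > 0" "d - (int k)\<^sup>2 = int m"
      using False d_neq_power2[of "int k"] by (auto simp: m_def)
    have "int k \<le> (int k)\<^sup>2"
      by (cases k) (auto simp: power2_eq_square)
    then have "k < nat (d + 1)"
      using False by linarith
    then have "?y \<in> R_plus_units"
      by (intro R_plus_units_add R_plus_units_of_nat_mult less) auto
    then have "of_nat m * (\<alpha> gchoose k) \<in> R_plus_units"
      unfolding gbinomial_recurrence[symmetric] m(2) by simp
    then show ?thesis
      using m R_plus_units_of_nat_multD R_plus_gbinomial by blast
  qed
qed

lemma R_plus_uminus: "x \<in> R_plus \<alpha> \<Longrightarrow> - x \<in> R_plus \<alpha>"
proof (induction rule: R_plus_induct)
  case (gbinomial k)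
  show ?case
    using gbinomial_unit by (simp add: R_plus_units_def)
next
  case (add x y)
  then show ?case
    using R_plus_add[of "- x" \<alpha> "- y"] by simp
qed (simp add: R_plus_0)

lemma R_plus_1: "1 \<in> R_plus \<alpha>"
  using R_plus_gbinomial[of \<alpha> 0] by simp

lemma R_plus_\<alpha>: "\<alpha> \<in> R_plus \<alpha>"
  using R_plus_gbinomial[of \<alpha> 1] by simp

lemma is_subring_R_plus: "is_subring (R_plus \<alpha>)"
  by (simp add: is_subring_def R_plus_0 R_plus_1 R_plus_uminus R_plus_add R_plus_mult)

subsection \<open>Inverses of non-split primes\<close>

lemma R_plus_of_int: "of_int n \<in> R_plus \<alpha>"
proof -
  have "of_nat m \<in> R_plus \<alpha>" for m
    using R_plus_of_nat_mult[OF R_plus_1, of m] by simp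
  then show ?thesis
    by (cases n rule: int_cases2) (auto intro: R_plus_uminus)
qed

lemma R_plus_diff: "x \<in> R_plus \<alpha> \<Longrightarrow> y \<in> R_plus \<alpha> \<Longrightarrow> x - y \<in> R_plus \<alpha>"
  using R_plus_add[OF _ R_plus_uminus] by fastforce

lemma R_plus_of_nat: "of_nat n \<in> R_plus \<alpha>"
  using R_plus_of_int[of "int n"] by simp

lemma R_plus_numeral: "numeral w \<in> R_plus \<alpha>"
  using R_plus_of_nat[of "numeral w"] by simp

lemmas R_plus_intros = R_plus_0 R_plus_1 R_plus_numeral R_plus_\<alpha>
  R_plus_of_int R_plus_of_nat R_plus_add R_plus_diff R_plus_mult

text \<open>With s n + t p = 1 from Bezout, z / p = s (z w / p) w' + t z. Usually \<open>w'\<close>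
  is the conjugate of \<open>w\<close> and \<open>n\<close> its norm, both up to sign.\<close>

lemma R_plus_divide_prime_cancel:
  assumes "prime p" "z * w / of_nat p \<in> R_plus \<alpha>" "z \<in> R_plus \<alpha>"
    and "w' \<in> R_plus \<alpha>" "w * w' = of_int n" "\<not> int p dvd n"
  shows "z / of_nat p \<in> R_plus \<alpha>"
proof -
  have p: "p > 0"
    using assms(1) prime_gt_0_nat by blast
  have "gcd n (int p) = 1"
    using assms(1,6) prime_imp_coprime[of "int p" n] by (simp add: coprime_iff_gcd_eq_1 gcd.commute)
  then obtain s t where st: "s * n + t * int p = 1"
    using bezout_int by metis
  have "z / of_nat p = z * of_int (s * n + t * int p) / of_nat p"
    by (simp only: st of_int_1 mult_1_right)
  also have "\<dots> = of_int s * (z * w / of_nat p * w') + of_int t * z"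
    using p by (simp add: assms(5)[symmetric] field_simps)
  finally show ?thesis
    using assms(2-4) by (simp only: R_plus_intros)
qed

text \<open>Removes the factors one at a time; \<alpha> + j cancels \<alpha> - j because their
  product is d - j^2.\<close>

lemma R_plus_divide_prime_cancel_prod:
  assumes "prime p" "finite J" "\<And>j. j \<in> J \<Longrightarrow> \<not> int p dvd d - (int j)\<^sup>2"
    and "z \<in> R_plus \<alpha>" "z * (\<Prod>j\<in>J. \<alpha> - of_nat j) / of_nat p \<in> R_plus \<alpha>"
  shows "z / of_nat p \<in> R_plus \<alpha>"
  using assms(2-5)
proof (induction J arbitrary: z rule: finite_induct)
  case (insert j J)
  have "z * (\<alpha> - of_nat j) / of_nat p \<in> R_plus \<alpha>"
  proof (rule insert.IH)
    show "\<not> int p dvd d - (int i)\<^sup>2" if "i \<in> J" for i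
      using insert.prems(1) that by blast
    show "z * (\<alpha> - of_nat j) \<in> R_plus \<alpha>"
      using insert.prems(2) by (intro R_plus_intros)
    show "z * (\<alpha> - of_nat j) * (\<Prod>j\<in>J. \<alpha> - of_nat j) / of_nat p \<in> R_plus \<alpha>"
      using insert.prems(3) unfolding prod.insert[OF insert.hyps] by (simp only: mult.assoc)
  qed
  then show ?case
  proof (rule R_plus_divide_prime_cancel[OF assms(1)])
    show "\<alpha> + of_nat j \<in> R_plus \<alpha>"
      by (intro R_plus_intros)
    show "(\<alpha> - of_nat j) * (\<alpha> + of_nat j) = of_int (d - (int j)\<^sup>2)"
      by (simp add: distrib_left left_diff_distrib right_diff_distrib power2_eq_square mult.commute)
  qed (use insert.prems in auto)
qed simp

text \<open>The quotient is (p - 1)! times \<open>\<alpha> gchoose p\<close>.\<close>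

lemma falling_product_divide_in_R_plus:
  assumes "prime p"
  shows "(\<Prod>j<p. \<alpha> - of_nat j) / of_nat p \<in> R_plus \<alpha>"
proof -
  have p: "p > 0"
    using assms prime_gt_0_nat by blast
  have "(\<Prod>j<p. \<alpha> - of_nat j) = fact p * (\<alpha> gchoose p)"
    by (simp add: gbinomial_mult_fact atLeast0LessThan)
  also have "\<dots> = of_nat p * (of_nat (fact (p - 1)) * (\<alpha> gchoose p))"
    using p by (simp add: fact_reduce)
  finally have "(\<Prod>j<p. \<alpha> - of_nat j) / of_nat p = of_nat (fact (p - 1)) * (\<alpha> gchoose p)"
    using p by (simp only: nonzero_mult_div_cancel_left of_nat_eq_0_iff)
  then show ?thesis
    by (simp only: R_plus_of_nat_mult R_plus_gbinomial)
qed

text \<open>Among 0 <= j < p only j = 0 makes p divide d - j^2, so cancelling the other factors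
  leaves \<alpha> / p. Its square is e / p with e = d / p, and squarefreeness keeps e prime to
  p.\<close>

lemma inverse_prime_in_R_plus_if_dvd:
  assumes p: "prime p" and "int p dvd d"
  shows "1 / of_nat p \<in> R_plus \<alpha>"
proof -
  have p0: "p > 0" "\<not> is_unit (int p)"
    using p prime_gt_0_nat by (auto simp: prime_nat_iff)
  have "(\<Prod>j<p. \<alpha> - of_nat j) = \<alpha> * (\<Prod>j\<in>{1..<p}. \<alpha> - of_nat j)"
    using p0 by (subst lessThan_atLeast0, subst prod.atLeast_Suc_lessThan) auto
  moreover have "\<not> int p dvd d - (int j)\<^sup>2" if "j \<in> {1..<p}" for j
  proof
    assume "int p dvd d - (int j)\<^sup>2"
    then have "int p dvd (int j)\<^sup>2"
      using \<open>int p dvd d\<close> dvd_diff[of "int p" d "d - (int j)\<^sup>2"] by simp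
    then have "p dvd j"
      using p by (simp add: prime_dvd_power_iff)
    with that show False
      by (auto dest: dvd_imp_le)
  qed
  ultimately have "\<alpha> / of_nat p \<in> R_plus \<alpha>"
    using falling_product_divide_in_R_plus[OF p] R_plus_divide_prime_cancel_prod[OF p, of "{1..<p}" \<alpha>] R_plus_\<alpha>
    by simp
  from R_plus_mult[OF this this] have "of_int d / (of_nat p * of_nat p) \<in> R_plus \<alpha>"
    by simp
  moreover obtain e where e: "d = int p * e"
    using assms by blast
  ultimately have "1 * of_int e / of_nat p \<in> R_plus \<alpha>"
    using p0 by simp
  moreover have "\<not> int p dvd e"
  proof
    assume "int p dvd e"
    then have "(int p)\<^sup>2 dvd d"
      unfolding e power2_eq_square by (intro mult_dvd_mono) simp_all
    then show False
      using squarefreeD[OF squarefree_d] p0 by blast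
  qed
  ultimately show ?thesis
    using R_plus_divide_prime_cancel[OF p, of 1 "of_int e" 1 e] R_plus_1 by simp
qed

text \<open>Here p divides no d - j^2, so every factor of the falling product cancels.\<close>

lemma inverse_prime_in_R_plus_if_not_QuadRes:
  assumes p: "prime p" and "\<not> QuadRes (int p) d"
  shows "1 / of_nat p \<in> R_plus \<alpha>"
proof -
  have "\<not> int p dvd d - (int j)\<^sup>2" for j
    using assms(2) by (auto simp: QuadRes_def cong_iff_dvd_diff dvd_diff_commute)
  then show ?thesis
    using falling_product_divide_in_R_plus[OF p] R_plus_divide_prime_cancel_prod[OF p, of "{..<p}" 1] R_plus_1
    by simp
qed

text \<open>For p = 2 the falling product is \<alpha> (\<alpha> - 1), and \<alpha> cancels since
  \<alpha>^2 = d is odd.\<close>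

lemma half_pred_\<alpha>_in_R_plus:
  assumes "odd d"
  shows "(\<alpha> - 1) / 2 \<in> R_plus \<alpha>"
proof -
  have "(\<alpha> - 1) * \<alpha> / 2 \<in> R_plus \<alpha>"
    using falling_product_divide_in_R_plus[OF two_is_prime_nat] by (simp add: numeral_2_eq_2 mult.commute)
  then show ?thesis
    using R_plus_divide_prime_cancel[OF two_is_prime_nat, of "\<alpha> - 1" \<alpha> \<alpha> d] assms
      R_plus_\<alpha> R_plus_diff[OF R_plus_\<alpha> R_plus_1] by simp
qed

text \<open>The constant (d - 1) / 4 is half an odd integer for d = 3 mod 4 and an odd integer for d
  = 5 mod 8, which drives the next two lemmas.\<close>

lemma half_pred_\<alpha>_square:
  assumes "g = (\<alpha> - 1) / 2"
  shows "g * g = (of_int d - 1) / 4 - g"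
proof -
  have "\<alpha> = 2 * g + 1"
    by (simp add: assms diff_divide_distrib)
  then have "of_int d = (2 * g + 1) * (2 * g + 1)"
    using \<alpha>_mult_\<alpha> by simp
  then show ?thesis
    by (simp add: field_simps)
qed

lemma half_in_R_plus_3_mod_4:
  assumes "[d = 3] (mod 4)"
  shows "1 / 2 \<in> R_plus \<alpha>"
proof -
  obtain e where e: "d = 4 * e + 3"
    using cong_sym[OF assms] by (auto simp: cong_iff_lin)
  define g where "g = (\<alpha> - 1) / 2"
  have g: "g \<in> R_plus \<alpha>"
    unfolding g_def using e by (intro half_pred_\<alpha>_in_R_plus) simp
  \<comment> \<open>Here g^2 = e + 1/2 - g, and g = \<alpha> / 2 - 1/2.\<close>
  have "\<alpha> / 2 = of_int (e + 1) - g * g"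
    unfolding half_pred_\<alpha>_square[OF g_def] by (simp add: e g_def diff_divide_distrib add_divide_distrib)
  then have "\<alpha> / 2 \<in> R_plus \<alpha>"
    using g by (simp only: R_plus_diff R_plus_mult R_plus_of_int)
  then have "1 * \<alpha> / of_nat 2 \<in> R_plus \<alpha>"
    by simp
  from R_plus_divide_prime_cancel[OF two_is_prime_nat this R_plus_1 R_plus_\<alpha> \<alpha>_mult_\<alpha>] show ?thesis
    using e by simp
qed

text \<open>Now g is an algebraic integer, so the denominator 2 has to come from
  \<open>\<alpha> gchoose 4\<close>. The factors \<alpha>, \<alpha> - 2, g and g - 1 left over it
  all have odd norm and cancel.\<close>

lemma half_in_R_plus_5_mod_8:
  assumes "[d = 5] (mod 8)"
  shows "1 / 2 \<in> R_plus \<alpha>"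
proof -
  obtain e where e: "d = 8 * e + 5"
    using cong_sym[OF assms] by (auto simp: cong_iff_lin)
  define g where "g = (\<alpha> - 1) / 2"
  have g: "g \<in> R_plus \<alpha>"
    unfolding g_def using e by (intro half_pred_\<alpha>_in_R_plus) simp
  have gg: "g * g = of_int (2 * e + 1) - g"
    unfolding half_pred_\<alpha>_square[OF g_def] by (simp add: e add_divide_distrib)
  note cancel = R_plus_divide_prime_cancel[OF two_is_prime_nat]
  \<comment> \<open>Since 4! = 3 * 8, while \<alpha> - 1 = 2 g and \<alpha> - 3 = 2 (g - 1), a
    single 2 stays in the denominator.\<close>
  have "of_nat 3 * (\<alpha> gchoose 4) = (\<Prod>i = 0..<4. \<alpha> - of_nat i) / 8"
    using gbinomial_mult_fact[of 4 \<alpha>] by (simp add: fact_numeral field_simps)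
  also have "\<dots> = (g - 1) * g * (\<alpha> - 2) * \<alpha> / 2"
    by (simp add: eval_nat_numeral g_def field_simps)
  finally have "(g - 1) * g * (\<alpha> - 2) * \<alpha> / of_nat 2 \<in> R_plus \<alpha>"
    by (metis R_plus_of_nat_mult R_plus_gbinomial of_nat_numeral)
  then have "(g - 1) * g * (\<alpha> - 2) / of_nat 2 \<in> R_plus \<alpha>"
    by (rule cancel[where w' = \<alpha> and n = d]) (use e in \<open>intro R_plus_intros g \<alpha>_mult_\<alpha> | simp\<close>)+
  then have "(g - 1) * g / of_nat 2 \<in> R_plus \<alpha>"
  proof (rule cancel)
    show "(\<alpha> - 2) * (\<alpha> + 2) = of_int (d - 4)"
      by (simp add: distrib_left left_diff_distrib)
  qed (use e in \<open>intro R_plus_intros g | simp\<close>)+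
  then have "(g - 1) / of_nat 2 \<in> R_plus \<alpha>"
  proof (rule cancel)
    \<comment> \<open>The negated conjugates of g and g - 1 are g + 1 and g + 2.\<close>
    show "g * (g + 1) = of_int (2 * e + 1)"
      by (simp add: distrib_left gg)
  qed (intro R_plus_intros g | simp)+
  then have "1 * (g - 1) / of_nat 2 \<in> R_plus \<alpha>"
    by simp
  then have "1 / of_nat 2 \<in> R_plus \<alpha>"
  proof (rule cancel)
    show "(g - 1) * (g + 2) = of_int (2 * e - 1)"
      by (simp add: distrib_left left_diff_distrib gg)
  qed (intro R_plus_intros g | simp)+
  then show ?thesis
    by simp
qed

lemma half_in_R_plus:
  assumes "\<not> [d = 1] (mod 8)"
  shows "1 / 2 \<in> R_plus \<alpha>"
proof -
  have "d mod 8 \<noteq> 1"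
    using assms by (simp add: cong_def)
  then have "even d \<or> d mod 4 = 3 \<or> d mod 8 = 5"
    by presburger
  then consider "even d" | "[d = 3] (mod 4)" | "[d = 5] (mod 8)"
    unfolding cong_def by fastforce
  then show ?thesis
    using inverse_prime_in_R_plus_if_dvd[OF two_is_prime_nat] half_in_R_plus_3_mod_4 half_in_R_plus_5_mod_8
    by cases simp_all
qed

lemma inverse_prime_in_R_plus:
  assumes "prime p" "ext_legendre d p \<noteq> 1"
  shows "1 / of_nat p \<in> R_plus \<alpha>"
proof (cases "p = 2")
  case True
  then have "\<not> [d = 1] (mod 8)"
    using assms(2) by (auto simp: ext_legendre_def)
  then show ?thesis
    using half_in_R_plus True by simp
next
  case False
  then have "Legendre d (int p) \<noteq> 1"
    using assms(2) by (auto simp: ext_legendre_def)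
  then show ?thesis
    using assms(1) inverse_prime_in_R_plus_if_dvd inverse_prime_in_R_plus_if_not_QuadRes
    by (auto simp: Legendre_def cong_0_iff split: if_splits)
qed

subsection \<open>Integers of quadratic fields\<close>

text \<open>The rational combinations of 1 and \<alpha> form a subfield: an inverse is the conjugate
  divided by the norm.\<close>

lemma subfield_hull_\<alpha>D:
  assumes "x \<in> is_subfield hull {\<alpha>}"
  obtains a b where "x = of_rat a + of_rat b * \<alpha>"
proof -
  define K where "K = {of_rat a + of_rat b * \<alpha> | a b. True}"
  have KI: "x = of_rat a + of_rat b * \<alpha> \<Longrightarrow> x \<in> K" for x a b
    unfolding K_def by blast
  have "is_subfield K"
    unfolding is_subfield_def is_subring_def
  proof (intro conjI ballI impI)
    show "0 \<in> K" "1 \<in> K"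
      by (rule KI[of _ 0 0] KI[of _ 1 0], simp)+
  next
    fix x assume "x \<in> K"
    then obtain a b where x: "x = of_rat a + of_rat b * \<alpha>"
      unfolding K_def by blast
    show "- x \<in> K"
      by (rule KI[of _ "- a" "- b"]) (simp add: x of_rat_minus)
    define n where "n = a\<^sup>2 - of_int d * b\<^sup>2"
    assume "x \<noteq> 0"
    have n: "x * (of_rat a - of_rat b * \<alpha>) = of_rat n"
      by (simp add: x n_def algebra_simps power2_eq_square of_rat_diff of_rat_mult)
    \<comment> \<open>A zero norm would make the conjugate zero and hence, \<alpha> being
      irrational, also x.\<close>
    have "n \<noteq> 0"
    proof
      assume "n = 0"
      then have "of_rat a - of_rat b * \<alpha> = 0"
        using n \<open>x \<noteq> 0\<close> by simp
      then have "a = 0" "- b = 0"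
        using rat_lin_comb_eq_0D[of a "- b"] by (simp_all add: of_rat_minus)
      with x \<open>x \<noteq> 0\<close> show False
        by simp
    qed
    show "inverse x \<in> K"
    proof (rule KI[of _ "a / n" "- b / n"])
      have "inverse x = (of_rat a - of_rat b * \<alpha>) / of_rat n"
        using \<open>n \<noteq> 0\<close> by (intro inverse_unique)
            (simp only: times_divide_eq_right n divide_self of_rat_eq_0_iff not_False_eq_True)
      then show "inverse x = of_rat (a / n) + of_rat (- b / n) * \<alpha>"
        by (simp add: of_rat_divide of_rat_minus diff_divide_distrib)
    qed
  next
    fix x y assume "x \<in> K" "y \<in> K"
    then obtain a b a' b' where x: "x = of_rat a + of_rat b * \<alpha>" and y: "y = of_rat a' + of_rat b' * \<alpha>"
      unfolding K_def by blast
    show "x + y \<in> K"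
      by (rule KI[of _ "a + a'" "b + b'"]) (simp add: x y of_rat_add algebra_simps)
    show "x * y \<in> K"
      by (rule KI[of _ "a * a' + of_int d * (b * b')" "a * b' + b * a'"])
        (simp add: x y of_rat_add of_rat_mult algebra_simps)
  qed
  moreover have "\<alpha> \<in> K"
    by (rule KI[of _ 0 1]) simp
  ultimately have "is_subfield hull {\<alpha>} \<subseteq> K"
    by (intro hull_minimal) auto
  with assms that show thesis
    unfolding K_def by blast
qed

end

section \<open>Gauss's lemma for integer polynomials\<close>

lemma poly_map_of_int_add:
  "poly (map_poly of_int (p + q)) x = poly (map_poly of_int p) x + (poly (map_poly of_int q) x :: 'a :: comm_ring_1)"
  by (induction p q rule: poly_induct2) (simp_all add: map_poly_pCons algebra_simps)

lemma poly_map_of_int_smult: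
  "poly (map_poly of_int (Polynomial.smult c p)) x = of_int c * (poly (map_poly of_int p) x :: 'a :: comm_ring_1)"
  by (induction p) (simp_all add: map_poly_pCons algebra_simps)

lemma poly_map_of_int_mult:
  "poly (map_poly of_int (p * q)) x = poly (map_poly of_int p) x * (poly (map_poly of_int q) x :: 'a :: comm_ring_1)"
  by (induction p)
    (simp_all add: map_poly_pCons poly_map_of_int_add poly_map_of_int_smult algebra_simps)

text \<open>Gauss's lemma: pseudo-division by the primitive minimal polynomial \<^term>\<open>Q\<close> leaves no remainder,
  and comparing contents shows that it divides any monic integer polynomial vanishing at \<^term>\<open>x\<close>.\<close>

lemma is_unit_lead_coeff_if_algebraic_int:
  fixes x :: "'a :: field_char_0"
  assumes "algebraic_int x" and "content Q = 1" and root: "poly (map_poly of_int Q) x = 0"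
    and min: "\<And>r. r \<noteq> 0 \<Longrightarrow> poly (map_poly of_int r) x = 0 \<Longrightarrow> degree Q \<le> degree r"
  shows "is_unit (lead_coeff Q :: int)"
proof -
  obtain p where p: "poly (map_poly of_int p) x = 0" "lead_coeff p = 1"
    using assms(1) algebraic_int_altdef_ipoly by blast
  have "content p dvd lead_coeff p"
    by (rule content_dvd_coeff)
  then have "content p = 1"
    using p(2) by (metis normalize_content is_unit_normalize)
  obtain q r where qr: "pseudo_divmod p Q = (q, r)"
    by fastforce
  define c where "c = lead_coeff Q ^ (Suc (degree p) - degree Q)"
  have "Q \<noteq> 0"
    using assms(2) by auto
  note div = pseudo_divmod[OF this qr, folded c_def]
  have "poly (map_poly of_int (Polynomial.smult c p)) x = poly (map_poly of_int (Q * q + r)) x"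
    using div(1) by simp
  then have "poly (map_poly of_int r) x = 0"
    by (simp add: poly_map_of_int_add poly_map_of_int_mult poly_map_of_int_smult p root)
  then have "r = 0"
    using div(2) min[of r] by force
  then have eq: "Polynomial.smult c p = Q * q"
    using div(1) by simp
  obtain q' where q': "q = Polynomial.smult (content q) q'"
    by (metis content_times_primitive_part)
  \<comment> \<open>Both \<open>p\<close> and \<open>Q\<close> are primitive, so the contents of the
    two sides are |c| and \<open>content q\<close>. Comparing leading coefficients then makes
    \<open>lead_coeff Q\<close> a divisor of a unit.\<close>
  have "\<bar>c\<bar> = content q"
    using arg_cong[OF eq, of content] \<open>content p = 1\<close> assms(2) by (simp add: content_mult)
  moreover have "c = content q * (lead_coeff Q * lead_coeff q')"
  proof -
    have "lead_coeff q = content q * lead_coeff q'"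
      using arg_cong[OF q', of lead_coeff] by (simp only: lead_coeff_smult)
    moreover have "c * lead_coeff p = lead_coeff Q * lead_coeff q"
      using arg_cong[OF eq, of lead_coeff] by (simp only: lead_coeff_smult lead_coeff_mult)
    ultimately show ?thesis
      using p(2) by simp
  qed
  ultimately have "\<bar>c\<bar> * 1 = \<bar>c\<bar> * \<bar>lead_coeff Q * lead_coeff q'\<bar>"
    by (metis abs_idempotent abs_mult mult_1_right)
  moreover have "c \<noteq> 0"
    using \<open>Q \<noteq> 0\<close> by (simp add: c_def)
  ultimately have "\<bar>lead_coeff Q * lead_coeff q'\<bar> = 1"
    by simp
  then show ?thesis
    by (metis abs_dvd_iff dvd_triv_left is_unit_mult_iff dvd_abs_iff one_dvd)
qed

context quadratic_irrational begin

text \<open>If b is nonzero, the minimal polynomial is X^2 - t X + n with trace t and norm n. By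
  Gauss's lemma its primitive integer multiple has a unit as leading coefficient, so t and n are
  integers.\<close>

lemma algebraic_int_trace_norm:
  assumes "algebraic_int (of_rat a + of_rat b * \<alpha>)"
  shows "2 * a \<in> \<int>" "a\<^sup>2 - of_int d * b\<^sup>2 \<in> \<int>"
proof -
  define x where "x = of_rat a + of_rat b * \<alpha>"
  define t n where "t = 2 * a" and "n = a\<^sup>2 - of_int d * b\<^sup>2"
  have "t \<in> \<int> \<and> n \<in> \<int>"
  proof (cases "b = 0")
    case True
    then have "algebraic_int (of_rat a :: complex)"
      using assms by simp
    then have "(of_rat a :: complex) \<in> \<int>"
      by (rule rational_algebraic_int_is_int) simp
    then obtain m where "(of_rat a :: complex) = of_int m"
      by (auto elim: Ints_cases)
    then have "(of_rat a :: complex) = of_rat (of_int m)"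
      by simp
    then have "a = of_int m"
      by (simp only: of_rat_eq_iff)
    then show ?thesis
      by (simp add: t_def n_def True)
  next
    case False
    have linear: "r = 0 \<and> s = 0" if "of_rat r + of_rat s * x = 0" for r s
    proof -
      have "of_rat (r + s * a) + of_rat (s * b) * \<alpha> = 0"
        using that by (simp add: x_def of_rat_add of_rat_mult algebra_simps)
      from rat_lin_comb_eq_0D[OF this] False show ?thesis
        by simp
    qed
    have square: "x * x = of_rat t * x - of_rat n"
      by (simp add: x_def t_def n_def of_rat_diff of_rat_mult power2_eq_square algebra_simps)
    obtain t1 t2 where t: "t = of_int t1 / of_int t2" "t2 > 0"
      by (metis Fract_of_int_quotient Rat_cases)
    obtain n1 n2 where n: "n = of_int n1 / of_int n2" "n2 > 0"
      by (metis Fract_of_int_quotient Rat_cases)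
    \<comment> \<open>\<open>P\<close> is t2 n2 (X^2 - t X + n).\<close>
    define P where "P = [:n1 * t2, - (t1 * n2), t2 * n2:]"
    define Q where "Q = primitive_part P"
    have "P \<noteq> 0" "degree P = 2"
      using t(2) n(2) by (auto simp: P_def)
    have P: "P = Polynomial.smult (content P) Q"
      by (simp add: Q_def)
    have "degree Q = 2"
      using \<open>degree P = 2\<close> by (simp add: Q_def)
    have "poly (map_poly of_int P) x = of_int (t2 * n2) * (x * x - of_rat t * x + of_rat n)"
      using t(2) n(2) by (simp add: P_def map_poly_pCons t(1) n(1) of_rat_divide field_simps)
    then have root: "poly (map_poly of_int Q) x = 0"
      using \<open>P \<noteq> 0\<close> by (subst (asm) P) (simp add: poly_map_of_int_smult square)
    have unit: "is_unit (lead_coeff Q)"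
    proof (rule is_unit_lead_coeff_if_algebraic_int)
      show "algebraic_int x"
        using assms by (simp add: x_def)
      show "content Q = 1"
        using \<open>P \<noteq> 0\<close> by (simp add: Q_def)
      fix r :: "int poly"
      assume r: "r \<noteq> 0" "poly (map_poly of_int r) x = 0"
      show "degree Q \<le> degree r"
      proof (rule ccontr)
        assume "\<not> degree Q \<le> degree r"
        then have "degree r \<le> 1"
          using \<open>degree Q = 2\<close> by simp
        then have "r = [:poly.coeff r 0, poly.coeff r 1:]"
          by (intro poly_eqI) (auto simp: coeff_pCons coeff_eq_0 split: nat.splits)
        then obtain r0 r1 where r01: "r = [:r0, r1:]"
          by blast
        have "of_rat (of_int r0) + of_rat (of_int r1) * x = 0"
          using r(2) by (simp add: r01 map_poly_pCons mult.commute)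
        then show False
          using linear[of "of_int r0" "of_int r1"] r(1) r01 by simp
      qed
    qed (rule root)
    define c where "c = poly.coeff Q"
    have Q: "Q = [:c 0, c 1, c 2:]"
      using \<open>degree Q = 2\<close> by (intro poly_eqI)
          (auto simp: c_def coeff_pCons coeff_eq_0 numeral_2_eq_2 split: nat.splits)
    have "\<bar>c 2\<bar> = 1"
      using unit \<open>degree Q = 2\<close> by (simp add: c_def)
    \<comment> \<open>Substituting x^2 = t x - n turns Q(x) = 0 into a rational linear relation
      between 1 and x, whose coefficients vanish.\<close>
    have "of_rat (of_int (c 0) - of_int (c 2) * n) + of_rat (of_int (c 1) + of_int (c 2) * t) * x
        = of_int (c 0) + of_int (c 1) * x + of_int (c 2) * (x * x)"
      by (simp add: square of_rat_diff of_rat_add of_rat_mult algebra_simps)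
    also have "\<dots> = 0"
      using root by (subst (asm) Q) (simp add: map_poly_pCons algebra_simps)
    finally have "of_int (c 2) * n = of_int (c 0)" "of_int (c 2) * t = of_int (- c 1)"
      using linear by (force simp: eq_neg_iff_add_eq_0 add.commute)+
    then have "of_int (c 2 * c 2) * n = of_int (c 2 * c 0)" "of_int (c 2 * c 2) * t = of_int (- (c 2 * c 1))"
      by (simp_all add: mult.assoc)
    moreover have "c 2 * c 2 = 1"
      using \<open>\<bar>c 2\<bar> = 1\<close> by (auto simp: abs_if split: if_splits)
    ultimately have "n = of_int (c 2 * c 0)" "t = of_int (- (c 2 * c 1))"
      by simp_all
    then show ?thesis
      by (metis Ints_of_int)
  qed
  then show "2 * a \<in> \<int>" "a\<^sup>2 - of_int d * b\<^sup>2 \<in> \<int>"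
    by (simp_all add: t_def n_def)
qed

text \<open>Write 2 b = s / q in lowest terms. Integrality of trace and norm makes q^2 divide d s^2,
  hence d, and squarefreeness gives q = 1.\<close>

lemma algebraic_int_half_int_coords:
  assumes "algebraic_int (of_rat a + of_rat b * \<alpha>)"
  obtains u v where "of_rat a + of_rat b * \<alpha> = (of_int u + of_int v * \<alpha>) / 2" "4 dvd u\<^sup>2 - d * v\<^sup>2"
proof -
  obtain u N where u: "2 * a = of_int u" and N: "a\<^sup>2 - of_int d * b\<^sup>2 = of_int N"
    using algebraic_int_trace_norm[OF assms] by (auto elim!: Ints_cases)
  obtain s q where sq: "2 * b = of_int s / of_int q" "q > 0" "coprime s q"
    by (metis Fract_of_int_quotient Rat_cases)
  have "of_int d * (2 * b)\<^sup>2 = (2 * a)\<^sup>2 - 4 * (a\<^sup>2 - of_int d * b\<^sup>2)"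
    by (simp add: power2_eq_square algebra_simps)
  also have "\<dots> = of_int (u\<^sup>2 - 4 * N)"
    by (simp add: u N)
  finally have eq: "of_int d * (2 * b)\<^sup>2 = of_int (u\<^sup>2 - 4 * N)" .
  then have "of_int (d * s\<^sup>2) = (of_int ((u\<^sup>2 - 4 * N) * q\<^sup>2) :: rat)"
    using \<open>q > 0\<close> unfolding sq(1) by (simp add: field_simps)
  then have "d * s\<^sup>2 = (u\<^sup>2 - 4 * N) * q\<^sup>2"
    by (simp only: of_int_eq_iff)
  then have "q\<^sup>2 dvd d * s\<^sup>2"
    by simp
  then have "q\<^sup>2 dvd d"
    using \<open>coprime s q\<close> by (simp add: coprime_dvd_mult_left_iff coprime_commute)
  then have "q = 1"
    using squarefreeD[OF squarefree_d, of q] \<open>q > 0\<close> by simp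
  then have v: "2 * b = of_int s"
    using sq(1) by simp
  have "of_int (d * s\<^sup>2) = (of_int (u\<^sup>2 - 4 * N) :: rat)"
    using eq by (simp add: v)
  then have "d * s\<^sup>2 = u\<^sup>2 - 4 * N"
    by (simp only: of_int_eq_iff)
  then have "4 dvd u\<^sup>2 - d * s\<^sup>2"
    by simp
  moreover have "of_rat a + of_rat b * \<alpha> = (of_rat (2 * a) + of_rat (2 * b) * \<alpha>) / 2"
    by (simp add: of_rat_mult)
  then have "of_rat a + of_rat b * \<alpha> = (of_int u + of_int s * \<alpha>) / 2"
    by (simp add: u v)
  ultimately show thesis
    using that by blast
qed

text \<open>Half-integral coordinates suffice once 1/2 is available. For d = 1 mod 8 the numbers u
  and v have equal parity, and (\<alpha> - 1) / 2 does the rest.\<close>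

lemma ring_of_integers_subset_R_plus: "ring_of_integers (is_subfield hull {\<alpha>}) \<subseteq> R_plus \<alpha>"
proof
  fix x assume "x \<in> ring_of_integers (is_subfield hull {\<alpha>})"
  then have "x \<in> is_subfield hull {\<alpha>}" "algebraic_int x"
    by (auto simp: ring_of_integers_def)
  then obtain u v where x: "x = (of_int u + of_int v * \<alpha>) / 2" and dvd: "4 dvd u\<^sup>2 - d * v\<^sup>2"
    by (metis subfield_hull_\<alpha>D algebraic_int_half_int_coords)
  show "x \<in> R_plus \<alpha>"
  proof (cases "[d = 1] (mod 8)")
    case True
    then have "d mod 8 = 1"
      by (simp add: cong_def)
    then have "odd d"
      by presburger
    have "even (u\<^sup>2 - d * v\<^sup>2)"
      using dvd by presburger
    then have "even (u + v)"
      using \<open>odd d\<close> by simp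
    then obtain w where w: "u = 2 * w - v"
      by (metis add_diff_cancel_right' evenE)
    have "x = of_int w + of_int v * ((\<alpha> - 1) / 2)"
      by (simp add: x w field_simps)
    then show ?thesis
      using half_pred_\<alpha>_in_R_plus[OF \<open>odd d\<close>] by (simp only: R_plus_add R_plus_mult R_plus_of_int)
  next
    case False
    have "x = (of_int u + of_int v * \<alpha>) * (1 / 2)"
      by (simp add: x)
    then show ?thesis
      by (simp only: R_plus_intros half_in_R_plus False not_False_eq_True)
  qed
qed

end

subsection \<open>Integrality at split primes\<close>

text \<open>Hensel lifting: adding p^(n+1) s to r changes r^2 - d by 2 r s p^(n+1) modulo p^(n+2),
  and 2 r is invertible modulo p.\<close>

lemma square_root_mod_odd_prime_power:
  fixes d :: int
  assumes "prime p" "odd p" "QuadRes p d" "\<not> p dvd d"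
  shows "\<exists>r. p ^ n dvd r\<^sup>2 - d"
proof -
  \<comment> \<open>Starting at exponent 1 makes \<open>QuadRes\<close> the base case and keeps p
    from dividing r.\<close>
  have "\<exists>r. p ^ Suc n dvd r\<^sup>2 - d"
  proof (induction n)
    case 0
    show ?case
      using assms(3) by (auto simp: QuadRes_def cong_iff_dvd_diff)
  next
    case (Suc n)
    then obtain r t where rt: "r\<^sup>2 - d = p ^ Suc n * t"
      by blast
    have "\<not> p dvd r"
    proof
      assume "p dvd r"
      then have "p dvd r\<^sup>2 - (r\<^sup>2 - d)"
        unfolding rt by (intro dvd_diff) (auto simp: power2_eq_square)
      with assms(4) show False
        by simp
    qed
    moreover have "\<not> p dvd 2"
      using assms(1,2) primes_dvd_imp_eq[of p 2] by auto
    ultimately have "coprime (2 * r) p"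
      using assms(1) by (metis coprime_commute prime_dvd_mult_iff prime_imp_coprime)
    then obtain i where "[2 * r * i = 1] (mod p)"
      using cong_solve_coprime_int by blast
    then have "p dvd t * (1 - 2 * r * i)"
      by (simp add: cong_iff_dvd_diff dvd_diff_commute)
    moreover define s where "s = - (t * i)"
    moreover have "t * (1 - 2 * r * i) = t + 2 * r * s"
      by (simp add: s_def algebra_simps)
    ultimately obtain w where w: "t + 2 * r * s = p * w"
      by (auto elim: dvdE)
    have "(r + p ^ Suc n * s)\<^sup>2 - d = p ^ Suc n * (t + 2 * r * s) + p ^ Suc n * p ^ Suc n * s\<^sup>2"
      using rt by (simp add: power2_eq_square algebra_simps)
    also have "\<dots> = p ^ Suc (Suc n) * (w + p ^ n * s\<^sup>2)"
      unfolding w by (simp add: algebra_simps)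
    finally show ?case
      by (metis dvd_triv_left)
  qed
  then show ?thesis
    using dvd_trans[OF le_imp_power_dvd[of n "Suc n" p]] by (meson lessI less_imp_le)
qed

text \<open>The derivative 2 r is even, so lifting starts at 8, where r = 1 works, and shifts r by
  only half the modulus times t. The new error is 8 q (t + r t) modulo 16 q, and t + r t is even
  because r is odd.\<close>

lemma square_root_mod_power_of_2:
  fixes d :: int
  assumes "[d = 1] (mod 8)"
  shows "\<exists>r. 2 ^ n dvd r\<^sup>2 - d"
proof -
  have "d mod 8 = 1"
    using assms by (simp add: cong_def)
  then have "odd d"
    by presburger
  have "\<exists>r. 2 ^ (n + 3) dvd r\<^sup>2 - d"
  proof (induction n)
    case 0
    show ?case
      using \<open>d mod 8 = 1\<close> by (intro exI[of _ 1]) (simp add: mod_eq_dvd_iff[symmetric])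
  next
    case (Suc n)
    define q :: int where "q = 2 ^ n"
    from Suc obtain r t where "r\<^sup>2 - d = 2 ^ (n + 3) * t"
      by blast
    then have rt: "r\<^sup>2 - d = 8 * q * t"
      by (simp add: q_def power_add)
    have "even (r\<^sup>2 - d)"
      unfolding rt by simp
    then have "odd r"
      using \<open>odd d\<close> by simp
    then have "even (t + r * t)"
      by simp
    then obtain w where w: "t + r * t = 2 * w"
      by blast
    have "(r + 4 * q * t)\<^sup>2 - d = (r\<^sup>2 - d) + 8 * q * (r * t) + 16 * q * (q * t\<^sup>2)"
      by (simp add: power2_eq_square algebra_simps)
    also have "\<dots> = 8 * q * (t + r * t) + 16 * q * (q * t\<^sup>2)"
      unfolding rt by (simp add: distrib_left)
    also have "\<dots> = 2 ^ (Suc n + 3) * (w + q * t\<^sup>2)"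
      unfolding w by (simp add: q_def power_add algebra_simps)
    finally show ?case
      by (metis dvd_triv_left)
  qed
  then show ?thesis
    using dvd_trans[OF le_imp_power_dvd[of n "n + 3" "2 :: int"]] by auto
qed

lemma square_root_mod_split_prime_power:
  assumes "prime p" "ext_legendre d p = 1"
  shows "\<exists>r. int p ^ n dvd r\<^sup>2 - d"
proof (cases "p = 2")
  case True
  have "[d = 1] (mod 8)"
    using assms(2) True by (auto simp: ext_legendre_def complex_eq_iff split: if_splits)
  then show ?thesis
    using square_root_mod_power_of_2 True by simp
next
  case False
  then have "of_int (Legendre d (int p)) = (of_int 1 :: complex)"
    using assms(2) by (simp add: ext_legendre_def)
  then have "Legendre d (int p) = 1"
    by (simp only: of_int_eq_iff)
  then have "QuadRes (int p) d" "\<not> int p dvd d"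
    by (auto simp: Legendre_def cong_0_iff split: if_splits)
  then show ?thesis
    using assms(1) False square_root_mod_odd_prime_power[of "int p" d n]
    by (metis even_of_nat prime_nat_int_transfer primes_dvd_imp_eq two_is_prime_nat)
qed

section \<open>Divisibility prime by prime, and generated subrings\<close>

lemma int_dvd_if_prime_power_dvd:
  assumes "n > 0" "\<And>p m. prime p \<Longrightarrow> p ^ m dvd n \<Longrightarrow> int (p ^ m) dvd x"
  shows "int n dvd x"
proof -
  have "n dvd nat \<bar>x\<bar>"
  proof (cases "x = 0")
    case False
    show ?thesis
    proof (rule multiplicity_le_imp_dvd)
      fix p :: nat assume p: "prime p"
      have "p ^ multiplicity p n dvd nat \<bar>x\<bar>"
        using assms(2)[OF p multiplicity_dvd]
        by (simp only: int_dvd_int_iff[symmetric] nat_0_le abs_ge_zero dvd_abs_iff)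
      then show "multiplicity p n \<le> multiplicity p (nat \<bar>x\<bar>)"
        using p False by (intro multiplicity_geI) auto
    qed (use assms in auto)
  qed simp
  then show ?thesis
    by (simp only: int_dvd_int_iff[symmetric] nat_0_le abs_ge_zero dvd_abs_iff)
qed

text \<open>Will be applied to k!: \<open>A\<close> collects the primes to be inverted,
  \<open>B\<close> those at which integrality must be shown.\<close>

lemma nat_split_by_primes:
  fixes n :: nat
  assumes "n > 0"
  obtains A B where "n = A * B" "\<And>p. prime p \<Longrightarrow> p dvd A \<Longrightarrow> P p" "\<And>p. prime p \<Longrightarrow> p dvd B \<Longrightarrow> \<not> P p"
proof -
  have "\<exists>A B. n = A * B \<and> (\<forall>p. prime p \<longrightarrow> p dvd A \<longrightarrow> P p) \<and> (\<forall>p. prime p \<longrightarrow> p dvd B \<longrightarrow> \<not> P p)"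
    using assms
  proof (induction n rule: prime_divisors_induct)
    case zero
    then show ?case
      by simp
  next
    case (unit n)
    then show ?case
      by (intro exI[of _ 1]) auto
  next
    case (factor p n)
    then obtain A B where AB: "n = A * B" "\<forall>p. prime p \<longrightarrow> p dvd A \<longrightarrow> P p" "\<forall>p. prime p \<longrightarrow> p dvd B \<longrightarrow> \<not> P p"
      by auto
    have *: "q dvd p * C \<Longrightarrow> q = p \<or> q dvd C" if "prime q" for q C
      using factor.hyps that primes_dvd_imp_eq by (auto simp: prime_dvd_mult_iff)
    have "p * n = p * A * B \<and> (\<forall>q. prime q \<longrightarrow> q dvd p * A \<longrightarrow> P q)" if "P p"
      using AB that *[of _ A] by (auto simp: mult.assoc)
    moreover have "p * n = A * (p * B) \<and> (\<forall>q. prime q \<longrightarrow> q dvd p * B \<longrightarrow> \<not> P q)" if "\<not> P p"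
      using AB that *[of _ B] by (auto simp: mult.left_commute)
    ultimately show ?case
      using AB(2,3) by blast
  qed
  with that show thesis
    by blast
qed

lemma is_subring_hull: "is_subring (is_subring hull S)"
  by (rule hull_in) (auto simp: is_subring_def)

lemma is_subfield_hull: "is_subfield (is_subfield hull S)"
  by (rule hull_in) (auto simp: is_subfield_def is_subring_def)

lemma is_subring_of_nat:
  assumes "is_subring R"
  shows "of_nat n \<in> R"
  using assms by (induction n) (auto simp: is_subring_def)

lemma is_subring_of_int:
  assumes "is_subring R"
  shows "of_int n \<in> R"
  using assms is_subring_of_nat[OF assms] by (cases n rule: int_cases2) (auto simp: is_subring_def)

lemma is_subring_divide_of_nat:
  fixes n :: nat
  assumes R: "is_subring R" and "x \<in> R" "n > 0" "\<And>p. prime p \<Longrightarrow> p dvd n \<Longrightarrow> 1 / of_nat p \<in> R"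
  shows "x / of_nat n \<in> R"
  using assms(3,4)
proof (induction n rule: prime_divisors_induct)
  case (unit n)
  then show ?case
    using \<open>x \<in> R\<close> by simp
next
  case (factor p n)
  then have "x / of_nat n * (1 / of_nat p) \<in> R"
    using R unfolding is_subring_def by (metis dvd_mult dvd_triv_left mult_pos_pos nat_0_less_mult_iff)
  then show ?case
    by (simp add: mult.commute)
qed simp

section \<open>Binomials of \<alpha> in the generated subring\<close>

context quadratic_irrational begin

text \<open>u + v X is the remainder of X (X - 1) ... (X - k + 1) modulo X^2 - d. Evaluation at
  \<alpha> gives the equality, evaluation at r the divisibility.\<close>

lemma falling_product_eq_linear:
  "\<exists>u v. (\<Prod>i = 0..<k. \<alpha> - of_nat i) = of_int u + of_int v * \<alpha> \<and>
    (\<forall>r. r\<^sup>2 - d dvd (\<Prod>i = 0..<k. r - int i) - (u + v * r))"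
proof (induction k)
  case 0
  show ?case
    by (rule exI[of _ 1], rule exI[of _ 0]) simp
next
  case (Suc k)
  then obtain u v where uv: "(\<Prod>i = 0..<k. \<alpha> - of_nat i) = of_int u + of_int v * \<alpha>"
    "\<And>r. r\<^sup>2 - d dvd (\<Prod>i = 0..<k. r - int i) - (u + v * r)"
    by blast
  show ?case
  \<comment> \<open>Coefficients of (u + v X) (X - k) after replacing X^2 by d.\<close>
  proof (rule exI[of _ "v * d - u * int k"], rule exI[of _ "u - v * int k"], intro conjI allI)
    show "(\<Prod>i = 0..<Suc k. \<alpha> - of_nat i) = of_int (v * d - u * int k) + of_int (u - v * int k) * \<alpha>"
      by (simp add: uv(1) algebra_simps)
    fix r
    have "(\<Prod>i = 0..<Suc k. r - int i) - (v * d - u * int k + (u - v * int k) * r)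
        = ((\<Prod>i = 0..<k. r - int i) - (u + v * r)) * (r - int k) + v * (r\<^sup>2 - d)"
      by (simp add: power2_eq_square algebra_simps)
    also have "r\<^sup>2 - d dvd \<dots>"
      using uv(2) by (intro dvd_add dvd_mult2 dvd_mult) simp_all
    finally show "r\<^sup>2 - d dvd (\<Prod>i = 0..<Suc k. r - int i) - (v * d - u * int k + (u - v * int k) * r)" .
  qed
qed

text \<open>The quotient is a root of X^2 - t X + n with integers t = 2 u / B and n = (u^2 - d v^2)
  / B^2.\<close>

lemma algebraic_int_divide_of_trace_norm:
  assumes "B \<noteq> 0" "B dvd 2 * u" "B\<^sup>2 dvd u\<^sup>2 - d * v\<^sup>2"
  shows "algebraic_int ((of_int u + of_int v * \<alpha>) / of_int B)"
proof -
  obtain t n where t: "2 * u = B * t" and n: "u\<^sup>2 - d * v\<^sup>2 = B\<^sup>2 * n"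
    using assms by blast
  let ?x = "(of_int u + of_int v * \<alpha>) / of_int B"
  have t': "of_int t = (of_int (2 * u) / of_int B :: complex)"
    unfolding t using assms(1) by simp
  have n': "of_int n = (of_int (u\<^sup>2 - d * v\<^sup>2) / (of_int B)\<^sup>2 :: complex)"
    unfolding n using assms(1) by simp
  have "?x * ?x - of_int t * ?x + of_int n = 0"
    unfolding t' n' using assms(1) by (simp add: field_simps power2_eq_square)
  then show ?thesis
    by (intro algebraic_int.intros[of "[:of_int n, - of_int t, 1:]"])
      (auto simp: coeff_pCons algebra_simps split: nat.splits)
qed

text \<open>If \<open>r\<close> is a square root of \<open>d\<close> modulo a high power of a split prime, then \<open>u + v r\<close> and
  \<open>u - v r\<close> are congruent to falling factorials of \<open>r\<close> and \<open>- r\<close>, hence as divisible by this prime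
  as \<open>k!\<close>. Their sum and product control trace and norm of \<open>u + v \<alpha>\<close>.\<close>

lemma split_prime_power_dvd_trace_norm:
  assumes uv: "\<And>r. r\<^sup>2 - d dvd (\<Prod>i = 0..<k. r - int i) - (u + v * r)"
    and "prime p" "ext_legendre d p = 1" "p ^ m dvd fact k"
  shows "int (p ^ m) dvd 2 * u" "int (p ^ (2 * m)) dvd u\<^sup>2 - d * v\<^sup>2"
proof -
  \<comment> \<open>The norm needs precision 2 m; for the trace m is enough.\<close>
  obtain r where r: "int p ^ (2 * m) dvd r\<^sup>2 - d"
    using square_root_mod_split_prime_power assms(2,3) by blast
  have "int p ^ m dvd int p ^ (2 * m)"
    by (intro le_imp_power_dvd) simp
  then have r': "int p ^ m dvd r\<^sup>2 - d"
    using r dvd_trans by blast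
  \<comment> \<open>Used for s = r and s = - r; k! divides every product of k consecutive
    integers.\<close>
  have dvd: "int p ^ m dvd u + v * s" if "s\<^sup>2 = r\<^sup>2" for s
  proof -
    have "int (p ^ m) dvd int (fact k)"
      using assms(4) by (simp only: int_dvd_int_iff)
    then have "int p ^ m dvd (\<Prod>i = 0..<k. s - int i)"
      unfolding gbinomial_int_mult_fact[symmetric] by simp
    moreover have "int p ^ m dvd (\<Prod>i = 0..<k. s - int i) - (u + v * s)"
      using uv[of s] r' that by (metis dvd_trans)
    ultimately show ?thesis
      using dvd_diff[of "int p ^ m" "\<Prod>i = 0..<k. s - int i" "(\<Prod>i = 0..<k. s - int i) - (u + v * s)"]
      by simp
  qed
  have plus: "int p ^ m dvd u + v * r" and minus: "int p ^ m dvd u - v * r"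
    using dvd[of r] dvd[of "- r"] by simp_all
  then show "int (p ^ m) dvd 2 * u"
    using dvd_add[OF plus minus] by simp
  have "int p ^ (2 * m) dvd (u + v * r) * (u - v * r)"
    using mult_dvd_mono[OF plus minus] by (simp add: mult_2 power_add)
  then have "int p ^ (2 * m) dvd (u + v * r) * (u - v * r) + v\<^sup>2 * (r\<^sup>2 - d)"
    using r by (metis dvd_add dvd_mult)
  also have "(u + v * r) * (u - v * r) + v\<^sup>2 * (r\<^sup>2 - d) = u\<^sup>2 - d * v\<^sup>2"
    by (simp add: power2_eq_square algebra_simps)
  finally show "int (p ^ (2 * m)) dvd u\<^sup>2 - d * v\<^sup>2"
    by simp
qed

text \<open>Split k! = A B into its nonsplit and split parts. Trace and norm show that (u + v
  \<alpha>) / B is an algebraic integer, hence in R, and the primes dividing A are invertible in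
  R.\<close>

lemma gbinomial_in_subring:
  assumes R: "is_subring R"
    and O: "ring_of_integers (is_subfield hull {\<alpha>}) \<subseteq> R"
    and inv: "\<And>p. prime p \<Longrightarrow> ext_legendre d p \<noteq> 1 \<Longrightarrow> 1 / of_nat p \<in> R"
  shows "\<alpha> gchoose k \<in> R"
proof -
  obtain u v where uv: "(\<Prod>i = 0..<k. \<alpha> - of_nat i) = of_int u + of_int v * \<alpha>"
    "\<And>r. r\<^sup>2 - d dvd (\<Prod>i = 0..<k. r - int i) - (u + v * r)"
    using falling_product_eq_linear by blast
  have "(fact k :: nat) > 0"
    by simp
  then obtain A B :: nat where AB: "fact k = A * B"
    and A: "\<And>p. prime p \<Longrightarrow> p dvd A \<Longrightarrow> ext_legendre d p \<noteq> 1"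
    and B: "\<And>p. prime p \<Longrightarrow> p dvd B \<Longrightarrow> ext_legendre d p = 1"
    by (rule nat_split_by_primes[where P = "\<lambda>p. ext_legendre d p \<noteq> 1"]) blast
  have "A * B > 0"
    unfolding AB[symmetric] by simp
  then have pos: "A > 0" "B > 0"
    by simp_all
  have split: "ext_legendre d p = 1" if "prime p" "p ^ m dvd B" "m > 0" for p m
    using B that dvd_power[of m p] dvd_trans by blast
  have "int B dvd 2 * u"
  proof (rule int_dvd_if_prime_power_dvd[OF \<open>B > 0\<close>])
    fix p m :: nat assume p: "prime p" "p ^ m dvd B"
    have "p ^ m dvd fact k"
      unfolding AB using p(2) by simp
    then show "int (p ^ m) dvd 2 * u"
      using split[OF p] split_prime_power_dvd_trace_norm(1)[OF uv(2) p(1)] by (cases "m = 0") auto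
  qed
  moreover have "int (B\<^sup>2) dvd u\<^sup>2 - d * v\<^sup>2"
  proof (rule int_dvd_if_prime_power_dvd)
    fix p n :: nat assume p: "prime p" "p ^ n dvd B\<^sup>2"
    \<comment> \<open>As n may be odd, divisibility is shown for p^(2 m), the full power of p in
      B^2.\<close>
    define m where "m = multiplicity p B"
    have "n \<le> multiplicity p (B\<^sup>2)"
      using p \<open>B > 0\<close> by (intro multiplicity_geI) auto
    also have "\<dots> = 2 * m"
      using p(1) \<open>B > 0\<close> by (simp add: m_def prime_elem_multiplicity_power_distrib)
    finally have "n \<le> 2 * m" .
    have "p ^ m dvd B"
      unfolding m_def by (rule multiplicity_dvd)
    moreover from this have "p ^ m dvd fact k"
      unfolding AB by simp
    ultimately have "int (p ^ (2 * m)) dvd u\<^sup>2 - d * v\<^sup>2"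
      using split[OF p(1)] split_prime_power_dvd_trace_norm(2)[OF uv(2) p(1)] by (cases "m = 0") auto
    moreover have "int (p ^ n) dvd int (p ^ (2 * m))"
      using \<open>n \<le> 2 * m\<close> by (simp only: int_dvd_int_iff le_imp_power_dvd)
    ultimately show "int (p ^ n) dvd u\<^sup>2 - d * v\<^sup>2"
      using dvd_trans by blast
  qed (use pos in simp)
  ultimately have "algebraic_int ((of_int u + of_int v * \<alpha>) / of_int (int B))"
    using pos by (intro algebraic_int_divide_of_trace_norm) simp_all
  moreover have "(of_int u + of_int v * \<alpha>) / of_int (int B) \<in> is_subfield hull {\<alpha>}"
  proof -
    define K where "K = is_subfield hull {\<alpha>}"
    have K: "is_subfield K" "is_subring K" "\<alpha> \<in> K"
      using is_subfield_hull[of "{\<alpha>}"] by (auto simp: K_def is_subfield_def intro: hull_inc)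
    have int: "of_int n \<in> K" for n
      using K(2) by (rule is_subring_of_int)
    have "of_int (int B) \<noteq> (0 :: complex)"
      using pos by simp
    then have "inverse (of_int (int B)) \<in> K"
      using K(1) int unfolding is_subfield_def by blast
    then show ?thesis
      unfolding K_def[symmetric] divide_inverse using K(2,3) int by (simp add: is_subring_def)
  qed
  ultimately have "(of_int u + of_int v * \<alpha>) / of_int (int B) \<in> R"
    using O unfolding ring_of_integers_def by blast
  then have "(of_int u + of_int v * \<alpha>) / of_int (int B) / of_nat A \<in> R"
    using pos(1) A inv by (blast intro: is_subring_divide_of_nat[OF R])
  moreover have "\<alpha> gchoose k = (of_int u + of_int v * \<alpha>) / of_nat (fact k)"
    unfolding uv(1)[symmetric] gbinomial_mult_fact[symmetric] by simp
  ultimately show ?thesis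
    by (simp only: AB) (simp add: mult.commute)
qed

end

theorem theorem7p4:
  fixes d :: int
  assumes "squarefree d" and "d \<noteq> 1"
  shows "R_plus (csqrt (of_int d)) =
    subring_gen (ring_of_integers (quadratic_field d) \<union>
      {1 / of_nat p | p :: nat. prime p \<and> ext_legendre d p \<noteq> 1})"
proof -
  interpret quadratic_irrational d "csqrt (of_int d)"
    using assms by unfold_locales simp_all
  let ?S = "ring_of_integers (quadratic_field d) \<union>
      {1 / of_nat p | p :: nat. prime p \<and> ext_legendre d p \<noteq> 1}"
  have sub: "is_subring (subring_gen ?S)" and S: "?S \<subseteq> subring_gen ?S"
    unfolding subring_gen_def by (rule is_subring_hull, rule hull_subset)
  \<comment> \<open>A subring contains all natural combinations of its elements, so the binomials
    suffice for one inclusion.\<close>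
  have gbinomial: "csqrt (of_int d) gchoose k \<in> subring_gen ?S" for k
  proof (rule gbinomial_in_subring[OF sub])
    show "ring_of_integers (is_subfield hull {csqrt (of_int d)}) \<subseteq> subring_gen ?S"
      using S unfolding quadratic_field_def by (rule Un_subset_iff[THEN iffD1, THEN conjunct1])
    show "1 / of_nat p \<in> subring_gen ?S" if "prime p" "ext_legendre d p \<noteq> 1" for p
      using that by (intro subsetD[OF S] UnI2) blast
  qed
  show ?thesis
  proof
    show "R_plus (csqrt (of_int d)) \<subseteq> subring_gen ?S"
    proof
      fix x assume "x \<in> R_plus (csqrt (of_int d))"
      then show "x \<in> subring_gen ?S"
      proof (induction rule: R_plus_induct)
        case (add x y)
        then show ?case
          using sub unfolding is_subring_def by blast
      qed (use sub is_subring_def gbinomial in blast)+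
    qed
    have "?S \<subseteq> R_plus (csqrt (of_int d))"
      using inverse_prime_in_R_plus ring_of_integers_subset_R_plus
      unfolding quadratic_field_def by blast
    then show "subring_gen ?S \<subseteq> R_plus (csqrt (of_int d))"
      unfolding subring_gen_def using is_subring_R_plus by (rule hull_minimal)
  qed
qed

end
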